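(* Let $c>0$ and $\alpha$ be real constants such that $p=\dfrac{c}{N^{\alpha}}\in(0,1]$ for all sufficiently large $N$, and let $G_N$ be the random intersection graph of $N$ independent uniform spherical caps, each of area $4\pi p$, on the unit sphere. Then: (i) for $0<\alpha<1$, there is no isolated vertex in $G_N$ almost surely; (ii) for $\alpha<2$, there is at least one isolated vertex in $G_N$ almost surely; (iii) for $\alpha>3$, every vertex in $G_N$ is an isolated vertex almost surely.
   Context: Let $S^2$ be the unit sphere in $\mathbb{R}^3$, with total area $4\pi$. Let $X_1,X_2,\ldots$ be independent random points on a common probability space, each uniformly distributed on $S^2$. For a given $N$ and angular radius $a=a(N)$, let $C_i$ ($1\le i\le N$) be the (closed) spherical cap with center $X_i$ and angular radius $a$, i.e. the set of points of $S^2$ at geodesic distance at most $a$ from $X_i$. Let $p=p(a)=\sin^2(a/2)$ be the probability that a fixed point of the sphere is covered by a given cap; equivalently, each cap has area $4\pi p$. Prescribing $p\in(0,1]$ determines $a\in(0,\pi]$. The random intersection graph $G_N$ has vertex set $\mathcal{X}_N=\{X_1,\ldots,X_N\}$ and edge set $\mathcal{E}_N=\{X_iX_j: i\ne j,\ C_i\cap C_j\neq\emptyset\}$ (unordered pairs). A vertex is isolated if it belongs to no edge. "Almost surely" for a property of $G_N$ is meant in the Borel-Cantelli sense: with probability one there is a (random) $N_0$ such that the property holds for all $N\ge N_0$.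
   Formalization: In (ii) the range α<2 is replaced by α≥1: as printed, (ii) contradicts (i) for 0<α<1 (e.g. c=1, α=1/2) and also fails at α=0; the part 1≤α<2 where the claim holds is fully covered. *)

theory Defs
  imports "HOL-Probability.Probability"
begin

text \<open>
  Normalised surface area of the unit sphere, as the cone measure: the share of a Borel set
  \<open>A\<close> of the sphere is the share of the unit ball filled by the segments from the origin to the
  points of \<open>A\<close>. (The surface area of \<open>A\<close> itself is three times the volume of that cone.) The value
  at the origin of the radial projection is irrelevant, since the origin is a null set.
\<close>

definition uniform_sphere :: "(real^3) measure" where
  "uniform_sphere =
     distr (uniform_measure lborel (cball 0 1)) borel (\<lambda>x. x /\<^sub>R norm x)"

definition geodesic_dist :: "real^3 \<Rightarrow> real^3 \<Rightarrow> real" where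
  "geodesic_dist x y = arccos (x \<bullet> y)"

definition cap :: "real^3 \<Rightarrow> real \<Rightarrow> (real^3) set" where
  "cap x a = {y \<in> sphere 0 1. geodesic_dist x y \<le> a}"

text \<open>
  The share of the sphere taken up by a cap of angular radius \<open>a\<close>; it is strictly increasing on
  \<open>[0, \<pi>]\<close>, so it determines \<open>a\<close> there.
\<close>

definition cap_prob :: "real \<Rightarrow> real" where
  "cap_prob a = (sin (a / 2))\<^sup>2"

text \<open>
  The intersection graph of the caps of angular radius \<open>a\<close> centred at \<open>x 1, \<dots>, x N\<close>. Vertices are
  the centres themselves, not their indices, and edges are unordered pairs. If two centres happen
  to coincide they give one vertex, lying on the degenerate edge \<open>{x i, x j} = {x i}\<close>; for
  independent uniform centres this has probability zero.
\<close>

definition graph_verts :: "(nat \<Rightarrow> real^3) \<Rightarrow> nat \<Rightarrow> (real^3) set" where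
  "graph_verts x N = x ` {1..N}"

definition graph_edges :: "real \<Rightarrow> (nat \<Rightarrow> real^3) \<Rightarrow> nat \<Rightarrow> (real^3) set set" where
  "graph_edges a x N =
     {{x i, x j} | i j. i \<in> {1..N} \<and> j \<in> {1..N} \<and> i \<noteq> j \<and> cap (x i) a \<inter> cap (x j) a \<noteq> {}}"

definition isolated :: "real \<Rightarrow> (nat \<Rightarrow> real^3) \<Rightarrow> nat \<Rightarrow> real^3 \<Rightarrow> bool" where
  "isolated a x N v \<longleftrightarrow> v \<in> graph_verts x N \<and> (\<forall>e \<in> graph_edges a x N. v \<notin> e)"

text \<open>
  A range of exponents differs from the source. For \<open>p = c / N powr \<alpha>\<close> the source prints
  ``almost surely there is an isolated vertex'' for all \<open>\<alpha> < 2\<close>, and also ``almost surely there is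
  none'' for \<open>0 < \<alpha> < 1\<close>; these contradict each other. The theorem asserts existence for
  \<open>\<alpha> \<ge> 1\<close>, which covers the consistent part \<open>1 \<le> \<alpha> < 2\<close> of the printed range and also the reading
  \<open>\<alpha> > 2\<close>, should the inequality sign be a misprint.
\<close>

end

theory Submission
  imports Defs "HOL-Real_Asymp.Real_Asymp"
begin

text \<open>
  Everything is reduced to chordal distances between the centres. On the unit sphere, a cap of
  angular radius \<open>a\<close> consists of the points of the sphere at Euclidean distance at most \<open>2 * sqrt p\<close> from its
  centre, where \<open>p = cap_prob a\<close>. Hence two caps meet as soon as their centres are within
  \<open>2 * sqrt p\<close> (each then contains the centre of the other) and do not meet unless the centres are
  within \<open>4 * sqrt p\<close>. Since only the order of magnitude of \<open>p\<close> matters, this gap does no harm, and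
  the exact area of a cap can be replaced by two-sided bounds of order \<open>r\<^sup>2\<close> for the share of the
  sphere inside a ball of radius \<open>r\<close>. They come from covering the cone over the cap by balls
  (\<open>measure_uniform_sphere_cball_le\<close>) and from packing balls into it
  (\<open>measure_uniform_sphere_cball_ge\<close>).

  For \<open>\<alpha> < 1\<close> the expected number of isolated vertices is at most \<open>N * (1 - p / 128) ^ (N - 1)\<close>, and
  for \<open>\<alpha> > 3\<close> the expected number of edges is of order \<open>N\<^sup>2 * p\<close>. Both are summable, so the
  Borel-Cantelli lemma applies directly.

  For \<open>\<alpha> \<ge> 1\<close> each vertex is isolated with a probability bounded below, and two vertices are almost
  uncorrelated: once their neighbourhoods are disjoint, avoiding both is no likelier than avoiding
  them independently, and the neighbourhoods overlap with probability of order \<open>1 / N\<close> only.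
  Chebyshev's inequality therefore bounds the probability that there is no isolated vertex by a
  multiple of \<open>1 / N\<close> (\<open>prob_no_isolated_le\<close>). This is not summable over \<open>N\<close>, but it is summable
  over \<open>N = 2 ^ k\<close>. To reach every \<open>N\<close>, each dyadic block is treated at once: look for a vertex with
  index at most \<open>n = 2 ^ k\<close> that stays isolated among the first \<open>2 * n\<close> points when the caps have
  the radius belonging to \<open>n\<close>. Between \<open>n\<close> and \<open>2 * n\<close> there are fewer points and the caps are
  smaller, so that vertex is isolated for all \<open>N\<close> of the block.
\<close>

section \<open>The uniform distribution on the sphere\<close>

lemma borel_measurable_radial_projection [measurable]:
  "(\<lambda>x::real^3. x /\<^sub>R norm x) \<in> borel_measurable borel"
  by measurable

lemma content_cball_3: "0 \<le> r \<Longrightarrow> measure lborel (cball (z::real^3) r) = unit_ball_vol 3 * r ^ 3"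
  using content_cball[of r z] by simp

lemma content_ball_3: "0 \<le> r \<Longrightarrow> measure lborel (ball (z::real^3) r) = unit_ball_vol 3 * r ^ 3"
  using content_ball[of r z] by simp

lemma unit_ball_vol_3_pos: "unit_ball_vol 3 > 0"
  by (rule unit_ball_vol_pos) simp

lemma sets_uniform_sphere [simp, measurable_cong]: "sets uniform_sphere = sets borel"
  by (simp add: uniform_sphere_def)

lemma space_uniform_sphere [simp]: "space uniform_sphere = UNIV"
  by (simp add: uniform_sphere_def)

lemma emeasure_unit_cball:
  "emeasure lborel (cball (0::real^3) 1) \<noteq> 0" "emeasure lborel (cball (0::real^3) 1) \<noteq> \<infinity>"
  using less_imp_neq[OF unit_ball_vol_3_pos] by (auto simp: emeasure_cball)

lemma prob_space_uniform_sphere: "prob_space uniform_sphere"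
  unfolding uniform_sphere_def
  by (intro prob_space.prob_space_distr prob_space_uniform_measure emeasure_unit_cball) measurable

lemma measure_uniform_sphere:
  assumes A: "A \<in> sets borel"
  shows "measure uniform_sphere A =
    measure lborel (cball 0 1 \<inter> {z. z /\<^sub>R norm z \<in> A}) / unit_ball_vol 3"
proof -
  have [measurable]: "{z. z /\<^sub>R norm z \<in> A} \<in> sets borel"
    using measurable_sets[OF borel_measurable_radial_projection A] by (simp add: vimage_def)
  have "measure uniform_sphere A =
      measure (uniform_measure lborel (cball 0 1)) {z. z /\<^sub>R norm z \<in> A}"
    unfolding uniform_sphere_def using A
    by (subst measure_distr) (auto simp: vimage_def)
  also have "\<dots> = measure lborel (cball 0 1 \<inter> {z. z /\<^sub>R norm z \<in> A}) / measure lborel (cball (0::real^3) 1)"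
    by (rule measure_uniform_measure[OF emeasure_unit_cball]) simp
  finally show ?thesis
    by (simp add: content_cball_3)
qed

lemma AE_uniform_sphere_norm: "AE x in uniform_sphere. norm x = 1"
proof -
  have "AE z in lborel. z \<noteq> (0::real^3)"
    by (rule AE_lborel_singleton)
  hence "AE z in uniform_measure lborel (cball (0::real^3) 1). norm (z /\<^sub>R norm z) = 1"
    by (intro AE_uniform_measureI) (auto simp: emeasure_unit_cball)
  thus ?thesis
    unfolding uniform_sphere_def by (subst AE_distr_iff) auto
qed

text \<open>
  A point \<open>z\<close> of the cone over the ball is within \<open>r\<close> of \<open>norm z *\<^sub>R x\<close>. Thus the cone lies in a thin
  tube around a segment, which about \<open>1 / r\<close> balls of radius \<open>3 * r\<close> cover, and their total volume
  is of order \<open>r\<^sup>2\<close>. The estimates for random points below ask for such a bound uniformly over all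
  centres, on the sphere or off it; a ball that is small and far from the sphere misses it.
\<close>

lemma measure_uniform_sphere_cball_le:
  assumes r: "0 < r"
  shows "measure uniform_sphere (cball x r) \<le> 54 * r\<^sup>2"
proof -
  interpret prob_space uniform_sphere by (rule prob_space_uniform_sphere)
  have [measurable]: "cball x r \<in> sets borel" by simp
  consider "r \<ge> 1" | "r < 1" "norm x > 2" | "r < 1" "norm x \<le> 2"
    by linarith
  thus ?thesis
  proof cases
    case 1
    have "1 \<le> r\<^sup>2" using 1 by simp
    hence "1 \<le> 54 * r\<^sup>2" by linarith
    thus ?thesis using prob_le_1[of "cball x r"] by linarith
  next
    case 2
    have "norm (z /\<^sub>R norm z) \<le> 1" for z :: "real^3" by (cases "z = 0") auto
    hence "dist x (z /\<^sub>R norm z) > r" for z :: "real^3"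
      using 2 norm_triangle_ineq2[of x "z /\<^sub>R norm z"] unfolding dist_norm by (smt (verit))
    hence "{z. z /\<^sub>R norm z \<in> cball x r} = {}" by (auto simp: not_le)
    thus ?thesis by (simp add: measure_uniform_sphere)
  next
    case 3
    note 3 = 3 r
    \<comment> \<open>The balls are centred at the multiples of \<open>r *\<^sub>R x\<close>; each point of the cone goes
      to the last multiple of \<open>r\<close> below its norm.\<close>
    define K where "K = nat \<lfloor>1 / r\<rfloor>"
    have sub: "cball 0 1 \<inter> {z. z /\<^sub>R norm z \<in> cball x r} \<subseteq> (\<Union>k\<le>K. cball ((real k * r) *\<^sub>R x) (3 * r))"
    proof
      fix z assume z: "z \<in> cball 0 1 \<inter> {z. z /\<^sub>R norm z \<in> cball x r}"
      define k where "k = nat \<lfloor>norm z / r\<rfloor>"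
      have k: "real k \<le> norm z / r" "norm z / r \<le> real k + 1"
        unfolding k_def using 3 by (simp_all add: of_nat_nat)
      have "k \<le> K" unfolding k_def K_def using z 3
        by (intro nat_mono floor_mono divide_right_mono) auto
      have k': "\<bar>norm z - real k * r\<bar> \<le> r"
        using k 3 by (simp add: field_simps abs_le_iff)
      have "norm (z - norm z *\<^sub>R x) = norm z * norm (z /\<^sub>R norm z - x)"
      proof (cases "z = 0")
        case False
        have "z - norm z *\<^sub>R x = norm z *\<^sub>R (z /\<^sub>R norm z - x)"
          using False by (simp add: scaleR_diff_right)
        thus ?thesis by (metis norm_scaleR abs_norm_cancel)
      qed simp
      also have "\<dots> \<le> 1 * r"
        using z by (intro mult_mono) (auto simp: dist_norm norm_minus_commute)
      finally have 1: "norm (z - norm z *\<^sub>R x) \<le> r" by simp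
      have "norm (norm z *\<^sub>R x - (real k * r) *\<^sub>R x) = \<bar>norm z - real k * r\<bar> * norm x"
        by (simp flip: scaleR_diff_left)
      also have "\<dots> \<le> r * 2" using k' 3 by (intro mult_mono) auto
      finally have "dist z ((real k * r) *\<^sub>R x) \<le> 3 * r"
        using 1 norm_triangle_ineq[of "z - norm z *\<^sub>R x" "norm z *\<^sub>R x - (real k * r) *\<^sub>R x"]
        by (simp add: dist_norm)
      thus "z \<in> (\<Union>k\<le>K. cball ((real k * r) *\<^sub>R x) (3 * r))"
        using \<open>k \<le> K\<close> by (auto simp: dist_commute)
    qed
    have fin: "(\<Union>k\<le>K. cball ((real k * r) *\<^sub>R x) (3 * r)) \<in> fmeasurable lborel"
      by (intro fmeasurable.finite_UN fmeasurableI emeasure_lborel_cball_finite) auto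
    have "measure lborel (cball 0 1 \<inter> {z. z /\<^sub>R norm z \<in> cball x r})
        \<le> measure lborel (\<Union>k\<le>K. cball ((real k * r) *\<^sub>R x) (3 * r))"
      by (intro measure_mono_fmeasurable sub fin) measurable
    also have "\<dots> \<le> (\<Sum>k\<le>K. measure lborel (cball ((real k * r) *\<^sub>R x) (3 * r)))"
      by (intro measure_UNION_le) auto
    also have "\<dots> = (real K + 1) * (unit_ball_vol 3 * (3 * r) ^ 3)"
      using 3 by (simp add: content_cball_3 algebra_simps)
    also have "real K + 1 \<le> 2 / r"
    proof -
      have "real K \<le> 1 / r" unfolding K_def using 3 by (simp add: of_nat_nat)
      moreover have "1 \<le> 1 / r" using 3 by simp
      ultimately show ?thesis by simp
    qed
    finally have "measure lborel (cball 0 1 \<inter> {z. z /\<^sub>R norm z \<in> cball x r})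
        \<le> 2 / r * (unit_ball_vol 3 * (3 * r) ^ 3)"
      using 3 unit_ball_vol_3_pos by (simp add: mult_right_mono)
    also have "\<dots> = 54 * r\<^sup>2 * unit_ball_vol 3"
      using 3 by (simp add: field_simps power3_eq_cube power2_eq_square)
    finally show ?thesis
      using unit_ball_vol_3_pos by (simp add: measure_uniform_sphere field_simps)
  qed
qed

text \<open>
  Controls how far radial projection can move a point that starts near \<open>t *\<^sub>R x\<close>; this places small
  balls inside the cone over \<open>cball x r\<close>.
\<close>

lemma dist_radial_projection_le:
  fixes x z :: "real^3"
  assumes x: "norm x = 1" and t: "0 < t" and z: "z \<noteq> 0"
  shows "dist (z /\<^sub>R norm z) x \<le> 2 * dist z (t *\<^sub>R x) / t"
proof -
  define d where "d = dist z (t *\<^sub>R x)"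
  have "\<bar>norm z - t\<bar> \<le> d"
    using norm_triangle_ineq3[of z "t *\<^sub>R x"] x t by (simp add: d_def dist_norm)
  have "dist (z /\<^sub>R norm z) (z /\<^sub>R t) = \<bar>1 / norm z - 1 / t\<bar> * norm z"
    unfolding dist_norm by (simp flip: scaleR_diff_left add: divide_inverse)
  also have "\<dots> = \<bar>(1 / norm z - 1 / t) * norm z\<bar>" by (simp add: abs_mult)
  also have "(1 / norm z - 1 / t) * norm z = (t - norm z) / t"
    using t z by (simp add: field_simps)
  also have "\<bar>\<dots>\<bar> \<le> d / t"
    using \<open>\<bar>norm z - t\<bar> \<le> d\<close> t by (simp add: divide_right_mono abs_minus_commute)
  finally have 1: "dist (z /\<^sub>R norm z) (z /\<^sub>R t) \<le> d / t" .
  have "z /\<^sub>R t - x = (z - t *\<^sub>R x) /\<^sub>R t" using t by (simp add: scaleR_diff_right)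
  hence "dist (z /\<^sub>R t) x = d / t"
    unfolding d_def dist_norm using t by (simp add: divide_inverse)
  with 1 have "dist (z /\<^sub>R norm z) x \<le> d / t + d / t"
    using dist_triangle[of "z /\<^sub>R norm z" x "z /\<^sub>R t"] by linarith
  thus ?thesis by (simp add: d_def)
qed

text \<open>
  About \<open>1 / r\<close> disjoint balls of radius \<open>r / 8\<close> fit into the cone, in a row with their centres
  on the segment from \<open>x / 2\<close> to \<open>x\<close>.
\<close>

lemma measure_uniform_sphere_cball_ge:
  assumes x: "norm x = 1" and r: "0 < r" "r \<le> 2"
  shows "r\<^sup>2 / 512 \<le> measure uniform_sphere (cball x r)"
proof -
  have [measurable]: "cball x r \<in> sets borel" by simp
  \<comment> \<open>Projecting from height at least one half at most quadruples distances, so balls of radius up to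
    \<open>r / 4\<close> stay in the cone. The factor \<open>1 / 8\<close> moreover gives \<open>s \<le> 1 / 4\<close>, which leaves at least
    the length \<open>1 / 4\<close> of the segment for the row of centres.\<close>
  define s where "s = r / 8"
  have s: "0 < s" "s \<le> 1 / 4" using r by (auto simp: s_def)
  define K where "K = nat \<lfloor>(1 / 2 - s) / (2 * s)\<rfloor>"
  define t where "t k = 1 / 2 + 2 * s * real k" for k
  have K: "real K \<le> (1 / 2 - s) / (2 * s)" "(1 / 2 - s) / (2 * s) \<le> real K + 1"
    unfolding K_def using s by (simp_all add: of_nat_nat)
  have tK: "t k + s \<le> 1" if "k \<le> K" for k
  proof -
    have "real k \<le> (1 / 2 - s) / (2 * s)" using that K by linarith
    thus ?thesis using s by (simp add: t_def field_simps)
  qed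
  have t_ge: "t k \<ge> 1 / 2" for k using s by (simp add: t_def)
  let ?B = "\<lambda>k. ball (t k *\<^sub>R x) s"
  have sub: "(\<Union>k\<le>K. ?B k) \<subseteq> cball 0 1 \<inter> {z. z /\<^sub>R norm z \<in> cball x r}"
  proof safe
    fix k z assume k: "k \<le> K" and "z \<in> ?B k"
    hence d: "dist z (t k *\<^sub>R x) < s" by (simp add: dist_commute)
    have n: "norm (t k *\<^sub>R x) = t k" using x t_ge[of k] by simp
    have "norm z \<le> t k + s"
      using d n norm_triangle_sub[of z "t k *\<^sub>R x"] by (simp add: dist_norm)
    thus "z \<in> cball 0 1" using tK[OF k] by simp
    have "z \<noteq> 0" using d n t_ge[of k] s by (auto simp: dist_norm)
    hence "dist (z /\<^sub>R norm z) x \<le> 2 * dist z (t k *\<^sub>R x) / t k"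
      using x t_ge[of k] by (intro dist_radial_projection_le) auto
    also have "\<dots> \<le> 2 * s / (1 / 2)"
      using d s t_ge[of k] by (intro frac_le) auto
    also have "\<dots> \<le> r" using r by (simp add: s_def)
    finally show "z /\<^sub>R norm z \<in> cball x r" by (simp add: dist_commute)
  qed
  have disj: "disjoint_family_on ?B {..K}"
  proof (unfold disjoint_family_on_def, intro ballI impI)
    fix i j :: nat assume "i \<noteq> j"
    hence "1 \<le> \<bar>real i - real j\<bar>" by linarith
    hence "2 * s * 1 \<le> 2 * s * \<bar>real i - real j\<bar>" using s by (intro mult_left_mono) auto
    also have "\<dots> = \<bar>t i - t j\<bar>"
      using s by (simp add: t_def abs_mult flip: right_diff_distrib)
    also have "\<dots> = dist (t i *\<^sub>R x) (t j *\<^sub>R x)"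
      using x by (simp add: dist_norm flip: scaleR_diff_left)
    finally show "?B i \<inter> ?B j = {}"
      by (intro disjoint_ballI) auto
  qed
  have fm: "cball 0 1 \<inter> {z. z /\<^sub>R norm z \<in> cball x r} \<in> fmeasurable lborel"
    by (intro fmeasurable_Int_fmeasurable fmeasurableI emeasure_lborel_cball_finite) auto
  have "(1 / 2 - s) / (2 * s) \<ge> (1 / 4) / (2 * s)"
    using s by (intro divide_right_mono) auto
  hence "1 / (8 * s) \<le> real K + 1" using K(2) by simp
  hence "1 / (8 * s) * (unit_ball_vol 3 * s ^ 3) \<le> (real K + 1) * (unit_ball_vol 3 * s ^ 3)"
    using s unit_ball_vol_3_pos by (intro mult_right_mono) auto
  also have "\<dots> = (\<Sum>k\<le>K. measure lborel (?B k))"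
    using s by (simp add: content_ball_3 algebra_simps)
  also have "\<dots> = measure lborel (\<Union>k\<le>K. ?B k)"
    using disj less_imp_neq[OF emeasure_lborel_ball_finite]
    by (intro measure_finite_Union[symmetric]) auto
  also have "\<dots> \<le> measure lborel (cball 0 1 \<inter> {z. z /\<^sub>R norm z \<in> cball x r})"
    by (intro measure_mono_fmeasurable sub fm) auto
  finally have "s\<^sup>2 / 8 * unit_ball_vol 3 \<le> measure lborel (cball 0 1 \<inter> {z. z /\<^sub>R norm z \<in> cball x r})"
    using s by (simp add: field_simps power3_eq_cube power2_eq_square)
  hence "s\<^sup>2 / 8 \<le> measure uniform_sphere (cball x r)"
    using unit_ball_vol_3_pos by (simp add: measure_uniform_sphere field_simps)
  thus ?thesis by (simp add: s_def power_divide)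
qed

section \<open>Caps and chords\<close>

text \<open>
  A chord of central angle \<open>a\<close> has length \<open>2 * sin (a / 2)\<close>.
\<close>

lemma cap_prob_dist:
  fixes x y :: "real^3"
  assumes x: "norm x = 1" and y: "norm y = 1" and a: "0 \<le> a" "a \<le> pi"
  shows "geodesic_dist x y \<le> a \<longleftrightarrow> dist x y \<le> 2 * sqrt (cap_prob a)"
proof -
  have b: "\<bar>x \<bullet> y\<bar> \<le> 1" using Cauchy_Schwarz_ineq2[of x y] x y by simp
  have d: "(dist x y)\<^sup>2 = 2 - 2 * (x \<bullet> y)"
    using x y by (simp add: dist_norm power2_norm_eq_inner inner_diff inner_commute algebra_simps norm_eq_1)
  have c: "cos a = 1 - 2 * cap_prob a"
    using cos_double_sin[of "a / 2"] by (simp add: cap_prob_def)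
  have "geodesic_dist x y \<le> a \<longleftrightarrow> arccos (x \<bullet> y) \<le> arccos (cos a)"
    using a by (simp add: geodesic_dist_def arccos_cos)
  also have "\<dots> \<longleftrightarrow> cos a \<le> x \<bullet> y"
    using b by (intro arccos_le_mono) auto
  also have "\<dots> \<longleftrightarrow> (dist x y)\<^sup>2 \<le> (2 * sqrt (cap_prob a))\<^sup>2"
    unfolding d c power_mult_distrib by (simp add: cap_prob_def) linarith
  also have "\<dots> \<longleftrightarrow> dist x y \<le> 2 * sqrt (cap_prob a)"
    by (rule power_mono_iff) (auto simp: cap_prob_def)
  finally show ?thesis .
qed

lemma dist_le_if_caps_meet:
  assumes "norm x = 1" "norm y = 1" "0 \<le> a" "a \<le> pi" "cap x a \<inter> cap y a \<noteq> {}"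
  shows "dist x y \<le> 4 * sqrt (cap_prob a)"
proof -
  obtain z where "norm z = 1" "geodesic_dist x z \<le> a" "geodesic_dist y z \<le> a"
    using assms(5) by (auto simp: cap_def)
  hence "dist x z \<le> 2 * sqrt (cap_prob a)" "dist y z \<le> 2 * sqrt (cap_prob a)"
    using assms by (simp_all add: cap_prob_dist)
  thus ?thesis using dist_triangle2[of x y z] by linarith
qed

lemma caps_meet_if_dist_le:
  assumes "norm x = 1" "norm y = 1" "0 \<le> a" "a \<le> pi" "dist x y \<le> 2 * sqrt (cap_prob a)"
  shows "cap x a \<inter> cap y a \<noteq> {}"
proof -
  have "y \<in> cap x a" "y \<in> cap y a"
    using assms cap_prob_dist[of x y a] cap_prob_dist[of y y a] by (auto simp: cap_def cap_prob_def)
  thus ?thesis by blast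
qed

text \<open>
  Several indices may carry the point \<open>v\<close>, but testing one of them is enough: the caps around
  coinciding centres are equal, so an edge through another of these indices shows up at the tested
  one as well.
\<close>

lemma isolated_iff:
  "isolated a x N v \<longleftrightarrow>
    (\<exists>i\<in>{1..N}. v = x i \<and> (\<forall>j\<in>{1..N} - {i}. cap (x i) a \<inter> cap (x j) a = {}))"
  (is "?L \<longleftrightarrow> ?R")
proof
  assume ?L
  then obtain i where i: "i \<in> {1..N}" "v = x i" and e: "\<forall>e\<in>graph_edges a x N. x i \<notin> e"
    by (auto simp: isolated_def graph_verts_def)
  have "cap (x i) a \<inter> cap (x j) a = {}" if "j \<in> {1..N} - {i}" for j
  proof (rule ccontr)
    assume "cap (x i) a \<inter> cap (x j) a \<noteq> {}"
    hence "{x i, x j} \<in> graph_edges a x N"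
      using i that unfolding graph_edges_def by blast
    thus False using e by blast
  qed
  thus ?R using i by blast
next
  assume ?R
  then obtain i where i: "i \<in> {1..N}" "v = x i"
    and d: "\<And>j. j \<in> {1..N} - {i} \<Longrightarrow> cap (x i) a \<inter> cap (x j) a = {}" by blast
  have "v \<notin> e" if "e \<in> graph_edges a x N" for e
  proof
    assume "v \<in> e"
    from that obtain j k where jk: "e = {x j, x k}" "j \<in> {1..N}" "k \<in> {1..N}" "j \<noteq> k"
      "cap (x j) a \<inter> cap (x k) a \<noteq> {}" by (auto simp: graph_edges_def)
    from \<open>v \<in> e\<close> jk(1) i(2) have "x i = x j \<or> x i = x k" by auto
    moreover have False if "x i = x j"
      using that d[of k] d[of j] jk by (cases "k = i") (auto simp: Int_commute)
    moreover have False if "x i = x k"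
      using that d[of k] d[of j] jk by (cases "j = i") (auto simp: Int_commute)
    ultimately show False by blast
  qed
  thus ?L using i by (auto simp: isolated_def graph_verts_def)
qed

section \<open>Independent points with a common distribution\<close>

lemma (in sigma_finite_measure) borel_measurable_measure_Pair:
  assumes "S \<in> sets (N \<Otimes>\<^sub>M M)"
  shows "(\<lambda>x. measure M (Pair x -` S)) \<in> borel_measurable N"
  unfolding measure_def using measurable_emeasure_Pair[OF assms] by measurable

locale iid_points = prob_space M for M :: "'a measure" +
  fixes X :: "nat \<Rightarrow> 'a \<Rightarrow> 'b::{metric_space, second_countable_topology}"
    and \<mu> :: "'b measure" and I :: "nat set"
  assumes indep: "indep_vars (\<lambda>_. borel) X I"
    and distr_X: "i \<in> I \<Longrightarrow> distr M borel (X i) = \<mu>"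
begin

lemma X_measurable [measurable]: "i \<in> I \<Longrightarrow> X i \<in> borel_measurable M"
  using indep by (auto simp: indep_vars_def)

lemma sets_mu: "i \<in> I \<Longrightarrow> sets \<mu> = sets borel"
  using distr_X by (metis sets_distr)

lemma prob_space_mu: "i \<in> I \<Longrightarrow> prob_space \<mu>"
  using distr_X prob_space_distr X_measurable by metis

text \<open>
  Conditionally on the points with index in \<open>A\<close>, the points with index in \<open>J\<close> are still independent
  with distribution \<open>\<mu>\<close>. This is Fubini's theorem for the joint distribution of the two families. It
  is used with \<open>A\<close> a single index or a pair of indices.
\<close>

lemma prob_all_eq_expectation:
  assumes S: "S \<in> sets (PiM A (\<lambda>_. borel) \<Otimes>\<^sub>M borel)"
    and A: "A \<subseteq> I" "A \<inter> J = {}" and J: "finite J" "J \<subseteq> I" "J \<noteq> {}"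
  shows "prob {\<omega>\<in>space M. \<forall>j\<in>J. (restrict (\<lambda>i. X i \<omega>) A, X j \<omega>) \<in> S} =
    expectation (\<lambda>\<omega>. measure \<mu> (Pair (restrict (\<lambda>i. X i \<omega>) A) -` S) ^ card J)"
proof -
  define N :: "(nat \<Rightarrow> 'b) measure" where "N = PiM A (\<lambda>_. borel)"
  define Z where "Z \<omega> = restrict (\<lambda>i. X i \<omega>) A" for \<omega>
  have S: "S \<in> sets (N \<Otimes>\<^sub>M borel)" using S by (simp add: N_def)
  have ind: "indep_var N Z (PiM J (\<lambda>_. borel)) (\<lambda>\<omega>. restrict (\<lambda>j. X j \<omega>) J)"
    unfolding N_def Z_def using A J by (intro indep_var_restrict[OF indep]) auto
  obtain i where "i \<in> I" using J by auto
  note sets_mu [OF \<open>i \<in> I\<close>, measurable_cong]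
  interpret mu: prob_space \<mu> by (rule prob_space_mu[OF \<open>i \<in> I\<close>])
  have Z [measurable]: "Z \<in> measurable M N" using ind by (rule indep_var_rv1)
  have R [measurable]: "(\<lambda>\<omega>. restrict (\<lambda>j. X j \<omega>) J) \<in> measurable M (PiM J (\<lambda>_. borel))"
    using ind by (rule indep_var_rv2)
  note S [measurable]
  have S': "Pair z -` S \<in> sets \<mu>" for z
    using sets_Pair1[OF S] by (simp add: sets_mu[OF \<open>i \<in> I\<close>])
  let ?P = "PiM J (\<lambda>_. \<mu>)"
  let ?E = "{(z, y). z \<in> space N \<and> y \<in> (\<Pi>\<^sub>E j\<in>J. UNIV) \<and> (\<forall>j\<in>J. (z, y j) \<in> S)}"
  interpret P: prob_space ?P by (intro prob_space_PiM) (rule mu.prob_space_axioms)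
  have D: "distr M (PiM J (\<lambda>_. borel)) (\<lambda>\<omega>. restrict (\<lambda>j. X j \<omega>) J) = ?P"
  proof -
    have "distr M (PiM J (\<lambda>_. borel)) (\<lambda>\<omega>. restrict (\<lambda>j. X j \<omega>) J) = PiM J (\<lambda>j. distr M borel (X j))"
      using indep_vars_subset[OF indep J(2)] J
      by (subst (asm) indep_vars_iff_distr_eq_PiM') auto
    also have "\<dots> = ?P" using J by (intro PiM_cong) (auto simp: distr_X)
    finally show ?thesis .
  qed
  have setsP [measurable_cong]: "sets ?P = sets (PiM J (\<lambda>_. borel))"
    by (intro sets_PiM_cong) (auto simp: sets_mu[OF \<open>i \<in> I\<close>])
  have "?E = {x \<in> space (N \<Otimes>\<^sub>M PiM J (\<lambda>_. borel)). \<forall>j\<in>J. (fst x, snd x j) \<in> S}"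
    by (auto simp: space_pair_measure space_PiM)
  also have "\<dots> \<in> sets (N \<Otimes>\<^sub>M PiM J (\<lambda>_. borel))"
    using J by measurable
  finally have E: "?E \<in> sets (N \<Otimes>\<^sub>M PiM J (\<lambda>_. borel))" .
  have "emeasure M {\<omega>\<in>space M. \<forall>j\<in>J. (Z \<omega>, X j \<omega>) \<in> S} =
      emeasure (distr M (N \<Otimes>\<^sub>M PiM J (\<lambda>_. borel)) (\<lambda>\<omega>. (Z \<omega>, restrict (\<lambda>j. X j \<omega>) J))) ?E"
    using E measurable_space[OF Z] by (subst emeasure_distr) (auto intro!: arg_cong[where f="emeasure M"])
  also have "distr M (N \<Otimes>\<^sub>M PiM J (\<lambda>_. borel)) (\<lambda>\<omega>. (Z \<omega>, restrict (\<lambda>j. X j \<omega>) J)) =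
      distr M N Z \<Otimes>\<^sub>M ?P"
    using ind D by (simp add: indep_var_distribution_eq)
  also have "emeasure (distr M N Z \<Otimes>\<^sub>M ?P) ?E =
      (\<integral>\<^sup>+z. emeasure ?P (Pair z -` ?E) \<partial>distr M N Z)"
    using E by (intro P.emeasure_pair_measure_alt) (simp cong: sets_pair_measure_cong add: setsP)
  also have "\<dots> = (\<integral>\<^sup>+\<omega>. emeasure ?P (Pair (Z \<omega>) -` ?E) \<partial>M)"
  proof (intro nn_integral_distr Z)
    have "?E \<in> sets (N \<Otimes>\<^sub>M ?P)" using E by (simp cong: sets_pair_measure_cong add: setsP)
    thus "(\<lambda>z. emeasure ?P (Pair z -` ?E)) \<in> borel_measurable (distr M N Z)"
      unfolding measurable_distr_eq1 by (rule P.measurable_emeasure_Pair)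
  qed
  also have "\<dots> = (\<integral>\<^sup>+\<omega>. ennreal (measure \<mu> (Pair (Z \<omega>) -` S) ^ card J) \<partial>M)"
  proof (intro nn_integral_cong)
    fix \<omega> assume "\<omega> \<in> space M"
    hence "Z \<omega> \<in> space N" by (rule measurable_space[OF Z])
    hence "Pair (Z \<omega>) -` ?E = (\<Pi>\<^sub>E j\<in>J. Pair (Z \<omega>) -` S)"
      by (auto simp: PiE_iff extensional_def)
    moreover interpret product_prob_space "\<lambda>_. \<mu>" J by unfold_locales
    have "emeasure ?P (\<Pi>\<^sub>E j\<in>J. Pair (Z \<omega>) -` S) = (\<Prod>j\<in>J. emeasure \<mu> (Pair (Z \<omega>) -` S))"
      using J S' by (intro emeasure_PiM) auto
    ultimately show "emeasure ?P (Pair (Z \<omega>) -` ?E) = ennreal (measure \<mu> (Pair (Z \<omega>) -` S) ^ card J)"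
      by (simp add: mu.emeasure_eq_measure ennreal_power)
  qed
  also have "\<dots> = ennreal (expectation (\<lambda>\<omega>. measure \<mu> (Pair (Z \<omega>) -` S) ^ card J))"
  proof (rule nn_integral_eq_integral)
    have "S \<in> sets (N \<Otimes>\<^sub>M \<mu>)" using S by (simp cong: sets_pair_measure_cong add: sets_mu[OF \<open>i \<in> I\<close>])
    hence [measurable]: "(\<lambda>z. measure \<mu> (Pair z -` S)) \<in> borel_measurable N"
      by (rule mu.borel_measurable_measure_Pair)
    show "integrable M (\<lambda>\<omega>. measure \<mu> (Pair (Z \<omega>) -` S) ^ card J)"
      by (rule integrable_const_bound[where B = 1])
         (auto intro!: AE_I2 power_le_one mu.prob_le_1)
  qed auto
  finally show ?thesis
    unfolding Z_def[symmetric] by (simp add: emeasure_eq_measure integral_nonneg_AE)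
qed

lemma measurable_measure_cball:
  assumes "I \<noteq> {}"
  shows "(\<lambda>x. measure \<mu> (cball x r)) \<in> borel_measurable borel"
proof -
  obtain i where i: "i \<in> I" using assms by blast
  interpret mu: prob_space \<mu> by (rule prob_space_mu[OF i])
  have "{p \<in> space (borel \<Otimes>\<^sub>M borel). dist (fst p) (snd p :: 'b) \<le> r} \<in> sets (borel \<Otimes>\<^sub>M borel)"
    by measurable
  hence "{p. dist (fst p) (snd p) \<le> r} \<in> sets (borel \<Otimes>\<^sub>M \<mu>)"
    by (simp cong: sets_pair_measure_cong add: sets_mu[OF i] space_pair_measure)
  from mu.borel_measurable_measure_Pair[OF this] show ?thesis
    by (simp add: vimage_def cball_def)
qed

lemma prob_dist_le:
  fixes q :: real
  assumes ij: "i \<in> I" "j \<in> I" "i \<noteq> j" and q: "\<And>x. measure \<mu> (cball x r) \<le> q"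
  shows "prob {\<omega>\<in>space M. dist (X i \<omega>) (X j \<omega>) \<le> r} \<le> q"
proof -
  let ?P = "PiM {i} (\<lambda>_. borel) :: (nat \<Rightarrow> 'b) measure"
  let ?S = "{p \<in> space (?P \<Otimes>\<^sub>M borel). dist (fst p i) (snd p) \<le> r}"
  interpret mu: prob_space \<mu> by (rule prob_space_mu[OF ij(1)])
  have "prob {\<omega>\<in>space M. \<forall>k\<in>{j}. (restrict (\<lambda>i. X i \<omega>) {i}, X k \<omega>) \<in> ?S} =
      expectation (\<lambda>\<omega>. measure \<mu> (Pair (restrict (\<lambda>i. X i \<omega>) {i}) -` ?S) ^ card {j})"
  proof (rule prob_all_eq_expectation)
    show "?S \<in> sets (?P \<Otimes>\<^sub>M borel)" by measurable
  qed (use ij in auto)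
  hence "prob {\<omega>\<in>space M. dist (X i \<omega>) (X j \<omega>) \<le> r} = expectation (\<lambda>\<omega>. measure \<mu> (cball (X i \<omega>) r))"
    by (simp add: vimage_def cball_def space_pair_measure space_PiM)
  also have "\<dots> \<le> expectation (\<lambda>_. q)"
  proof (rule integral_mono)
    have [measurable]: "(\<lambda>x. measure \<mu> (cball x r)) \<in> borel_measurable borel"
      using ij by (intro measurable_measure_cball) auto
    show "integrable M (\<lambda>\<omega>. measure \<mu> (cball (X i \<omega>) r))"
      using ij by (intro integrable_const_bound[where B = 1]) auto
  qed (auto simp: q)
  finally show ?thesis by (simp add: prob_space)
qed

text \<open>
  The probability that \<open>k\<close> independent points all stay further than \<open>r\<close> from another independent one,
  written as the mean over the position of the latter.
\<close>

definition vacancy :: "real \<Rightarrow> nat \<Rightarrow> real" where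
  "vacancy r k = (\<integral>x. (1 - measure \<mu> (cball x r)) ^ k \<partial>\<mu>)"

lemma expectation_vacancy:
  assumes i: "i \<in> I"
  shows "expectation (\<lambda>\<omega>. (1 - measure \<mu> (cball (X i \<omega>) r)) ^ k) = vacancy r k"
proof -
  have [measurable]: "(\<lambda>x. measure \<mu> (cball x r)) \<in> borel_measurable borel"
    using i by (intro measurable_measure_cball) auto
  have "vacancy r k = (\<integral>x. (1 - measure \<mu> (cball x r)) ^ k \<partial>distr M borel (X i))"
    using i by (simp add: vacancy_def distr_X)
  also have "\<dots> = expectation (\<lambda>\<omega>. (1 - measure \<mu> (cball (X i \<omega>) r)) ^ k)"
    using i by (intro integral_distr) auto
  finally show ?thesis ..
qed

lemma integrable_vacancy:
  assumes i: "i \<in> I"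
  shows "integrable \<mu> (\<lambda>x. (1 - measure \<mu> (cball x r)) ^ k)"
    and "integrable M (\<lambda>\<omega>. (1 - measure \<mu> (cball (X i \<omega>) r)) ^ k)"
proof -
  note sets_mu[OF i, measurable_cong]
  interpret mu: prob_space \<mu> by (rule prob_space_mu[OF i])
  have [measurable]: "(\<lambda>x. measure \<mu> (cball x r)) \<in> borel_measurable borel"
    using i by (intro measurable_measure_cball) auto
  show "integrable \<mu> (\<lambda>x. (1 - measure \<mu> (cball x r)) ^ k)"
    by (intro mu.integrable_const_bound[where B = 1]) (auto intro!: power_le_one)
  show "integrable M (\<lambda>\<omega>. (1 - measure \<mu> (cball (X i \<omega>) r)) ^ k)"
    using i by (intro integrable_const_bound[where B = 1]) (auto intro!: power_le_one)
qed

lemma prob_isolated: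
  assumes i: "i \<in> I" "i \<notin> J" and J: "finite J" "J \<subseteq> I" "J \<noteq> {}"
  shows "prob {\<omega>\<in>space M. \<forall>j\<in>J. r < dist (X i \<omega>) (X j \<omega>)} = vacancy r (card J)"
proof -
  interpret mu: prob_space \<mu> by (rule prob_space_mu[OF i(1)])
  let ?P = "PiM {i} (\<lambda>_. borel) :: (nat \<Rightarrow> 'b) measure"
  let ?S = "{p \<in> space (?P \<Otimes>\<^sub>M borel). r < dist (fst p i) (snd p)}"
  have compl: "measure \<mu> (Pair (restrict (\<lambda>i. X i \<omega>) {i}) -` ?S) = 1 - measure \<mu> (cball (X i \<omega>) r)" for \<omega>
  proof -
    have "Pair (restrict (\<lambda>i. X i \<omega>) {i}) -` ?S = space \<mu> - cball (X i \<omega>) r"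
      using sets_eq_imp_space_eq[OF sets_mu[OF i(1)]] by (auto simp: space_pair_measure space_PiM)
    thus ?thesis by (simp add: mu.prob_compl sets_mu[OF i(1)])
  qed
  have "{\<omega>\<in>space M. \<forall>j\<in>J. r < dist (X i \<omega>) (X j \<omega>)} =
      {\<omega>\<in>space M. \<forall>k\<in>J. (restrict (\<lambda>i. X i \<omega>) {i}, X k \<omega>) \<in> ?S}"
    by (simp add: space_pair_measure space_PiM)
  also have "prob {\<omega>\<in>space M. \<forall>k\<in>J. (restrict (\<lambda>i. X i \<omega>) {i}, X k \<omega>) \<in> ?S} =
      expectation (\<lambda>\<omega>. measure \<mu> (Pair (restrict (\<lambda>i. X i \<omega>) {i}) -` ?S) ^ card J)"
  proof (rule prob_all_eq_expectation)
    show "?S \<in> sets (?P \<Otimes>\<^sub>M borel)" by measurable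
  qed (use i J in auto)
  also have "\<dots> = expectation (\<lambda>\<omega>. (1 - measure \<mu> (cball (X i \<omega>) r)) ^ card J)"
    by (simp only: compl)
  finally show ?thesis using i by (simp add: expectation_vacancy)
qed

text \<open>
  If the balls around two centres are disjoint, a further point misses both with probability
  \<open>1 - u - v \<le> (1 - u) * (1 - v)\<close>, where \<open>u\<close> and \<open>v\<close> are the measures of the balls. So the only
  positive correlation comes from overlapping balls, whose probability is at most \<open>Q\<close>.
\<close>

lemma prob_both_isolated_le:
  fixes Q :: real
  assumes ij: "i \<in> I" "j \<in> I" "i \<noteq> j" "i \<notin> J" "j \<notin> J"
    and J: "finite J" "J \<subseteq> I" "J \<noteq> {}"
    and Q: "\<And>x. measure \<mu> (cball x (2 * r)) \<le> Q"
  shows "prob {\<omega>\<in>space M. \<forall>k\<in>J. r < dist (X i \<omega>) (X k \<omega>) \<and> r < dist (X j \<omega>) (X k \<omega>)}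
    \<le> Q + (vacancy r (card J))\<^sup>2"
proof -
  note sets_mu = sets_mu[OF ij(1)]
  note sets_mu[measurable_cong]
  note [measurable] = X_measurable[OF ij(1)] X_measurable[OF ij(2)]
  interpret mu: prob_space \<mu> by (rule prob_space_mu[OF ij(1)])
  let ?P = "PiM {i, j} (\<lambda>_. borel) :: (nat \<Rightarrow> 'b) measure"
  let ?Z = "\<lambda>\<omega>. restrict (\<lambda>i. X i \<omega>) {i, j}"
  let ?S = "{p \<in> space (?P \<Otimes>\<^sub>M borel). r < dist (fst p i) (snd p) \<and> r < dist (fst p j) (snd p)}"
  define g where "g x = 1 - measure \<mu> (cball x r)" for x
  define h where "h \<omega> = measure \<mu> (Pair (?Z \<omega>) -` ?S)" for \<omega>
  have [measurable]: "g \<in> borel_measurable borel"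
    unfolding g_def using ij measurable_measure_cball by (intro borel_measurable_diff) auto
  have S [measurable]: "?S \<in> sets (?P \<Otimes>\<^sub>M borel)" by measurable
  have [measurable]: "h \<in> borel_measurable M"
    unfolding h_def
  proof (rule measurable_compose[of ?Z M ?P])
    show "?Z \<in> measurable M ?P" by (intro measurable_restrict) (use ij in auto)
    show "(\<lambda>z. measure \<mu> (Pair z -` ?S)) \<in> borel_measurable ?P"
      using S by (intro mu.borel_measurable_measure_Pair) (simp cong: sets_pair_measure_cong add: sets_mu)
  qed
  have g01: "0 \<le> g x" "g x \<le> 1" for x by (auto simp: g_def)
  have h01: "0 \<le> h \<omega>" "h \<omega> \<le> 1" for \<omega> by (auto simp: h_def)
  have h_le: "h \<omega> \<le> g (X i \<omega>) * g (X j \<omega>)" if "2 * r < dist (X i \<omega>) (X j \<omega>)" for \<omega>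
  proof -
    define x y where "x = X i \<omega>" and "y = X j \<omega>"
    have disj: "cball x r \<inter> cball y r = {}"
      using that unfolding x_def y_def by (intro disjoint_cballI) auto
    have "Pair (?Z \<omega>) -` ?S = space \<mu> - (cball x r \<union> cball y r)"
      using sets_eq_imp_space_eq[OF sets_mu]
      by (auto simp: space_pair_measure space_PiM x_def y_def)
    hence "h \<omega> = 1 - (measure \<mu> (cball x r) + measure \<mu> (cball y r))"
      unfolding h_def using disj
      by (simp add: mu.prob_compl sets_mu mu.finite_measure_Union)
    also have "\<dots> \<le> g x * g y"
      by (simp add: g_def algebra_simps)
    finally show ?thesis by (simp add: x_def y_def)
  qed
  have "{\<omega>\<in>space M. \<forall>k\<in>J. r < dist (X i \<omega>) (X k \<omega>) \<and> r < dist (X j \<omega>) (X k \<omega>)} =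
      {\<omega>\<in>space M. \<forall>k\<in>J. (?Z \<omega>, X k \<omega>) \<in> ?S}"
    by (simp add: space_pair_measure space_PiM)
  also have "prob {\<omega>\<in>space M. \<forall>k\<in>J. (?Z \<omega>, X k \<omega>) \<in> ?S} =
      expectation (\<lambda>\<omega>. h \<omega> ^ card J)"
    unfolding h_def using ij J
    by (intro prob_all_eq_expectation[OF S]) auto
  also have "\<dots> \<le> expectation (\<lambda>\<omega>. indicator {\<omega>\<in>space M. dist (X i \<omega>) (X j \<omega>) \<le> 2 * r} \<omega>
      + g (X i \<omega>) ^ card J * g (X j \<omega>) ^ card J)"
  proof (rule integral_mono)
    show "integrable M (\<lambda>\<omega>. h \<omega> ^ card J)"
      by (rule integrable_const_bound[where B = 1]) (auto simp: h01 intro!: power_le_one)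
    show "integrable M (\<lambda>\<omega>. indicator {\<omega>\<in>space M. dist (X i \<omega>) (X j \<omega>) \<le> 2 * r} \<omega>
        + g (X i \<omega>) ^ card J * g (X j \<omega>) ^ card J)"
      by (intro Bochner_Integration.integrable_add integrable_const_bound[where B = 1])
         (auto simp: g01 intro!: AE_I2 mult_le_one power_le_one)
    fix \<omega> assume "\<omega> \<in> space M"
    show "h \<omega> ^ card J \<le> indicator {\<omega>\<in>space M. dist (X i \<omega>) (X j \<omega>) \<le> 2 * r} \<omega>
        + g (X i \<omega>) ^ card J * g (X j \<omega>) ^ card J"
    proof (cases "dist (X i \<omega>) (X j \<omega>) \<le> 2 * r")
      case True
      thus ?thesis using \<open>\<omega> \<in> space M\<close>
        by (auto simp: h01 g01 intro!: add_increasing2 power_le_one)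
    next
      case False
      hence "h \<omega> ^ card J \<le> (g (X i \<omega>) * g (X j \<omega>)) ^ card J"
        by (intro power_mono h_le) (auto simp: h01)
      thus ?thesis using False by (simp add: power_mult_distrib)
    qed
  qed
  also have "\<dots> = prob {\<omega>\<in>space M. dist (X i \<omega>) (X j \<omega>) \<le> 2 * r}
      + expectation (\<lambda>\<omega>. g (X i \<omega>) ^ card J * g (X j \<omega>) ^ card J)"
    by (subst Bochner_Integration.integral_add)
       (auto simp: g01 intro!: integrable_const_bound[where B = 1] AE_I2 mult_le_one power_le_one)
  also have "expectation (\<lambda>\<omega>. g (X i \<omega>) ^ card J * g (X j \<omega>) ^ card J) =
      expectation (\<lambda>\<omega>. g (X i \<omega>) ^ card J) * expectation (\<lambda>\<omega>. g (X j \<omega>) ^ card J)"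
  proof (rule indep_var_lebesgue_integral)
    have "indep_var borel ((\<lambda>f. g (f i) ^ card J) \<circ> (\<lambda>\<omega>. restrict (\<lambda>j. X j \<omega>) {i}))
        borel ((\<lambda>f. g (f j) ^ card J) \<circ> (\<lambda>\<omega>. restrict (\<lambda>j. X j \<omega>) {j}))"
      using ij by (intro indep_var_compose[OF indep_var_restrict[OF indep]]) auto
    thus "indep_var borel (\<lambda>\<omega>. g (X i \<omega>) ^ card J) borel (\<lambda>\<omega>. g (X j \<omega>) ^ card J)"
      by (simp add: comp_def)
  qed (use integrable_vacancy ij in \<open>auto simp: g_def\<close>)
  also have "\<dots> = (vacancy r (card J))\<^sup>2"
    using ij by (simp add: g_def expectation_vacancy power2_eq_square)
  also have "prob {\<omega>\<in>space M. dist (X i \<omega>) (X j \<omega>) \<le> 2 * r} \<le> Q"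
    by (intro prob_dist_le ij Q)
  finally show ?thesis by simp
qed

lemma vacancy_ge:
  fixes q :: real
  assumes I: "I \<noteq> {}" and q: "\<And>x. measure \<mu> (cball x r) \<le> q" "q \<le> 1"
  shows "(1 - q) ^ k \<le> vacancy r k"
proof -
  obtain i where i: "i \<in> I" using I by blast
  interpret mu: prob_space \<mu> by (rule prob_space_mu[OF i])
  have "(\<integral>x. (1 - q) ^ k \<partial>\<mu>) \<le> vacancy r k"
    unfolding vacancy_def
    by (intro integral_mono integrable_vacancy[OF i] power_mono) (use q in auto)
  thus ?thesis by (simp add: mu.prob_space)
qed

lemma vacancy_le:
  fixes q :: real
  assumes I: "I \<noteq> {}" and q: "AE x in \<mu>. q \<le> measure \<mu> (cball x r)"
  shows "vacancy r k \<le> (1 - q) ^ k"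
proof -
  obtain i where i: "i \<in> I" using I by blast
  interpret mu: prob_space \<mu> by (rule prob_space_mu[OF i])
  have "vacancy r k \<le> (\<integral>x. (1 - q) ^ k \<partial>\<mu>)"
    unfolding vacancy_def
    by (intro integral_mono_AE integrable_vacancy[OF i])
       (use q in \<open>auto elim!: eventually_mono intro!: power_mono\<close>)
  thus ?thesis by (simp add: mu.prob_space)
qed

lemma vacancy_01:
  assumes I: "I \<noteq> {}"
  shows "0 \<le> vacancy r k" "vacancy r k \<le> 1"
proof -
  obtain i where i: "i \<in> I" using I by blast
  interpret mu: prob_space \<mu> by (rule prob_space_mu[OF i])
  show "vacancy r k \<le> 1" using vacancy_le[OF I, of 0 r k] by simp
  show "0 \<le> vacancy r k" using vacancy_ge[OF I, of r 1 k] zero_le_power[of "0::real" k]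
    by (simp del: zero_le_power)
qed

text \<open>
  Two vertices are compared on the points other than both of them, while a single vertex is tested
  against one point more; this bounds the loss.
\<close>

lemma vacancy_diff_le:
  fixes q :: real
  assumes I: "I \<noteq> {}" and q: "\<And>x. measure \<mu> (cball x r) \<le> q"
  shows "vacancy r k - vacancy r (Suc k) \<le> q"
proof -
  obtain i where i: "i \<in> I" using I by blast
  interpret mu: prob_space \<mu> by (rule prob_space_mu[OF i])
  have "vacancy r k - vacancy r (Suc k) =
      (\<integral>x. (1 - measure \<mu> (cball x r)) ^ k - (1 - measure \<mu> (cball x r)) ^ Suc k \<partial>\<mu>)"
    unfolding vacancy_def
    by (rule Bochner_Integration.integral_diff[symmetric]) (rule integrable_vacancy[OF i])+
  also have "\<dots> \<le> (\<integral>x. q \<partial>\<mu>)"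
  proof (intro integral_mono Bochner_Integration.integrable_diff integrable_vacancy[OF i])
    fix x
    have "(1 - measure \<mu> (cball x r)) ^ k - (1 - measure \<mu> (cball x r)) ^ Suc k =
        (1 - measure \<mu> (cball x r)) ^ k * measure \<mu> (cball x r)"
      by (simp add: algebra_simps)
    also have "\<dots> \<le> 1 * q"
      by (intro mult_mono power_le_one q) auto
    finally show "(1 - measure \<mu> (cball x r)) ^ k - (1 - measure \<mu> (cball x r)) ^ Suc k \<le> q"
      by simp
  qed simp
  finally show ?thesis by (simp add: mu.prob_space)
qed

text \<open>
  Chebyshev's inequality for the number of isolated vertices with index in \<open>V\<close>: its mean is
  \<open>card V * vacancy r (card W - 1)\<close>, and the variance consists of a diagonal part of at most \<open>card V\<close>
  and of covariances bounded by \<open>Q + 2 * q\<close>. Keeping \<open>V\<close> and \<open>W\<close> apart lets one apply it to the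
  vertices present at the beginning of a block against all points present at its end.
\<close>

lemma prob_no_isolated_le:
  fixes q Q :: real
  assumes V: "V \<subseteq> W" "V \<noteq> {}" and W: "finite W" "W \<subseteq> I" "3 \<le> card W"
    and q: "\<And>x. measure \<mu> (cball x r) \<le> q" "q < 1"
    and Q: "\<And>x. measure \<mu> (cball x (2 * r)) \<le> Q" "0 \<le> Q"
  shows "prob {\<omega>\<in>space M. \<forall>i\<in>V. \<exists>j\<in>W - {i}. dist (X i \<omega>) (X j \<omega>) \<le> r}
    \<le> (1 / card V + Q + 2 * q) / (1 - q) ^ (2 * (card W - 1))"
proof -
  have [measurable]: "X i \<in> borel_measurable M" if "i \<in> W" for i
    using W that by auto
  have I: "I \<noteq> {}" using V W by auto
  have finV: "finite V" using V W finite_subset by blast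
  have cV: "card V > 0" using finV V by (simp add: card_gt_0_iff)
  define m where "m = card W"
  define E where "E i = {\<omega>\<in>space M. \<forall>j\<in>W - {i}. r < dist (X i \<omega>) (X j \<omega>)}" for i
  have E [measurable]: "E i \<in> sets M" if "i \<in> V" for i
  proof -
    have [measurable]: "X i \<in> borel_measurable M" using V W that by auto
    show ?thesis unfolding E_def using W by measurable
  qed
  define S where "S \<omega> = (\<Sum>i\<in>V. indicator (E i) \<omega> :: real)" for \<omega>
  have S [measurable]: "S \<in> borel_measurable M" unfolding S_def by measurable
  define A where "A = vacancy r (m - 1)"
  define B where "B = vacancy r (m - 2)"
  have q0: "0 \<le> q" using q(1) measure_nonneg order_trans by blast
  have A_ge: "(1 - q) ^ (m - 1) \<le> A"
    unfolding A_def using q by (intro vacancy_ge I) auto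
  have A_pos: "A > 0" using A_ge zero_less_power[of "1 - q" "m - 1"] q by linarith
  have AB: "B - A \<le> q"
  proof -
    have "Suc (m - 2) = m - 1" using W by (simp add: m_def)
    thus ?thesis using vacancy_diff_le[OF I q(1), of "m - 2"] by (simp add: A_def B_def)
  qed
  have "B\<^sup>2 - A\<^sup>2 = (B - A) * (B + A)" by (simp add: algebra_simps power2_eq_square)
  also have "\<dots> \<le> q * (B + A)"
    using AB vacancy_01[OF I] by (intro mult_right_mono) (auto simp: A_def B_def)
  also have "\<dots> \<le> q * 2"
    using q0 vacancy_01[OF I, of r "m - 1"] vacancy_01[OF I, of r "m - 2"]
    by (intro mult_left_mono) (auto simp: A_def B_def)
  finally have BA: "B\<^sup>2 - A\<^sup>2 \<le> 2 * q" by simp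
  have pE: "prob (E i) = A" if "i \<in> V" for i
  proof -
    have "i \<in> W" using that V by auto
    moreover have "W - {i} \<noteq> {}"
    proof
      assume "W - {i} = {}"
      hence "W \<subseteq> {i}" by auto
      hence "card W \<le> 1" using card_mono[of "{i}" W] by simp
      thus False using W by simp
    qed
    ultimately show ?thesis
      unfolding E_def A_def m_def using W prob_isolated[of i "W - {i}" r] by auto
  qed
  have pEE: "prob (E i \<inter> E j) \<le> Q + B\<^sup>2" if "i \<in> V" "j \<in> V" "i \<noteq> j" for i j
  proof -
    let ?J = "W - {i, j}"
    have ij: "i \<in> W" "j \<in> W" using that V by auto
    note [measurable] = X_measurable[OF subsetD[OF W(2) ij(1)]] X_measurable[OF subsetD[OF W(2) ij(2)]]
    have c: "card ?J = m - 2" using ij that W by (simp add: card_Diff_subset m_def)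
    hence "?J \<noteq> {}" using W unfolding m_def by (metis card.empty diff_is_0_eq not_less_eq_eq numeral_2_eq_2 numeral_3_eq_3)
    have "prob (E i \<inter> E j) \<le>
        prob {\<omega>\<in>space M. \<forall>k\<in>?J. r < dist (X i \<omega>) (X k \<omega>) \<and> r < dist (X j \<omega>) (X k \<omega>)}"
    proof (rule finite_measure_mono)
      show "{\<omega>\<in>space M. \<forall>k\<in>?J. r < dist (X i \<omega>) (X k \<omega>) \<and> r < dist (X j \<omega>) (X k \<omega>)} \<in> events"
        using W by measurable
    qed (auto simp: E_def)
    also have "\<dots> \<le> Q + (vacancy r (card ?J))\<^sup>2"
      using ij that W \<open>?J \<noteq> {}\<close> Q by (intro prob_both_isolated_le) auto
    finally show ?thesis by (simp add: c B_def)
  qed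
  have ES: "expectation S = card V * A"
    unfolding S_def by (subst Bochner_Integration.integral_sum) (auto simp: pE integrable_real_indicator emeasure_eq_measure)
  have S2: "(S \<omega>)\<^sup>2 = (\<Sum>i\<in>V. \<Sum>j\<in>V. indicator (E i \<inter> E j) \<omega>)" for \<omega>
    unfolding S_def power2_eq_square sum_product by (simp add: indicator_inter_arith)
  have EIJ: "integrable M (indicator (E i \<inter> E j) :: 'a \<Rightarrow> real)" if "i \<in> V" "j \<in> V" for i j
    using that by (intro integrable_real_indicator) (auto simp: emeasure_eq_measure)
  have iS2: "integrable M (\<lambda>\<omega>. (S \<omega>)\<^sup>2)"
    unfolding S2 by (intro Bochner_Integration.integrable_sum EIJ)
  have iS: "integrable M S"
    unfolding S_def by (intro Bochner_Integration.integrable_sum integrable_real_indicator) (auto simp: emeasure_eq_measure)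
  have "expectation (\<lambda>\<omega>. (S \<omega>)\<^sup>2) = (\<Sum>i\<in>V. \<Sum>j\<in>V. prob (E i \<inter> E j))"
    unfolding S2 using EIJ
    by (subst Bochner_Integration.integral_sum, force intro!: Bochner_Integration.integrable_sum)
       (auto intro!: sum.cong simp: Bochner_Integration.integral_sum)
  also have "\<dots> \<le> (\<Sum>i\<in>V. \<Sum>j\<in>V. (if j = i then 1 else 0) + (Q + B\<^sup>2))"
    using pEE Q by (intro sum_mono) (auto intro: order_trans[OF prob_le_1] add_increasing2)
  also have "\<dots> = card V + (card V)\<^sup>2 * (Q + B\<^sup>2)"
    using finV by (simp add: sum.distrib power2_eq_square algebra_simps)
  finally have ES2: "expectation (\<lambda>\<omega>. (S \<omega>)\<^sup>2) \<le> card V + (card V)\<^sup>2 * (Q + B\<^sup>2)" .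
  have "{\<omega>\<in>space M. \<forall>i\<in>V. \<exists>j\<in>W - {i}. dist (X i \<omega>) (X j \<omega>) \<le> r}
      \<subseteq> {\<omega>\<in>space M. \<bar>S \<omega> - expectation S\<bar> \<ge> card V * A}"
  \<comment> \<open>If no vertex is isolated, then \<open>S\<close> is zero and misses its mean by the whole mean.\<close>
  proof safe
    fix \<omega> assume "\<omega> \<in> space M" and *: "\<forall>i\<in>V. \<exists>j\<in>W - {i}. dist (X i \<omega>) (X j \<omega>) \<le> r"
    have "\<omega> \<notin> E i" if "i \<in> V" for i
      using * that by (force simp: E_def)
    hence "S \<omega> = 0" by (simp add: S_def)
    thus "card V * A \<le> \<bar>S \<omega> - expectation S\<bar>" using A_pos by (simp add: ES)
  qed
  hence "prob {\<omega>\<in>space M. \<forall>i\<in>V. \<exists>j\<in>W - {i}. dist (X i \<omega>) (X j \<omega>) \<le> r}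
      \<le> prob {\<omega>\<in>space M. \<bar>S \<omega> - expectation S\<bar> \<ge> card V * A}"
    by (intro finite_measure_mono) measurable
  also have "\<dots> \<le> variance S / (card V * A)\<^sup>2"
    using cV A_pos by (intro Chebyshev_inequality iS2 S) auto
  also have "variance S = expectation (\<lambda>\<omega>. (S \<omega>)\<^sup>2) - (card V * A)\<^sup>2"
    by (subst variance_eq[OF iS iS2]) (simp add: ES)
  also have "\<dots> / (card V * A)\<^sup>2 \<le> (card V + (card V)\<^sup>2 * (Q + 2 * q)) / (card V * A)\<^sup>2"
  proof (rule divide_right_mono)
    have "(card V)\<^sup>2 * (B\<^sup>2 - A\<^sup>2) \<le> (card V)\<^sup>2 * (2 * q)"
      using BA by (intro mult_left_mono) auto
    thus "expectation (\<lambda>\<omega>. (S \<omega>)\<^sup>2) - (card V * A)\<^sup>2 \<le> card V + (card V)\<^sup>2 * (Q + 2 * q)"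
      using ES2 by (simp add: power_mult_distrib algebra_simps)
  qed simp
  also have "\<dots> = (1 / card V + Q + 2 * q) / A\<^sup>2"
    using cV A_pos by (simp add: field_simps power2_eq_square)
  also have "\<dots> \<le> (1 / card V + Q + 2 * q) / (1 - q) ^ (2 * (m - 1))"
  proof (rule divide_left_mono)
    show "(1 - q) ^ (2 * (m - 1)) \<le> A\<^sup>2"
      using power_mono[OF A_ge, of 2] q by (metis mult.commute power_mult diff_ge_0_iff_ge less_imp_le zero_le_power)
  qed (use A_pos q q0 Q in auto)
  finally show ?thesis by (simp add: m_def)
qed

lemma prob_some_pair_close_le:
  fixes q :: real
  assumes W: "finite W" "W \<subseteq> I"
    and q: "\<And>x. measure \<mu> (cball x r) \<le> q"
  shows "prob {\<omega>\<in>space M. \<exists>i\<in>W. \<exists>j\<in>W - {i}. dist (X i \<omega>) (X j \<omega>) \<le> r} \<le> (real (card W))\<^sup>2 * q"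
proof -
  let ?P = "{z \<in> W \<times> W. fst z \<noteq> snd z}"
  let ?E = "\<lambda>z. {\<omega>\<in>space M. dist (X (fst z) \<omega>) (X (snd z) \<omega>) \<le> r}"
  have q0: "0 \<le> q" using q measure_nonneg order_trans by blast
  have finP: "finite ?P" using W by (intro finite_subset[of ?P "W \<times> W"]) auto
  have E: "?E z \<in> events" if "z \<in> ?P" for z
  proof -
    have "fst z \<in> I" "snd z \<in> I" using that W by auto
    note [measurable] = this[THEN X_measurable]
    show ?thesis by measurable
  qed
  have "prob {\<omega>\<in>space M. \<exists>i\<in>W. \<exists>j\<in>W - {i}. dist (X i \<omega>) (X j \<omega>) \<le> r} = prob (\<Union>z\<in>?P. ?E z)"
  proof (rule arg_cong[where f = prob], intro set_eqI iffI)
    fix \<omega> assume "\<omega> \<in> {\<omega>\<in>space M. \<exists>i\<in>W. \<exists>j\<in>W - {i}. dist (X i \<omega>) (X j \<omega>) \<le> r}"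
    then obtain i j where "\<omega> \<in> space M" "i \<in> W" "j \<in> W - {i}" "dist (X i \<omega>) (X j \<omega>) \<le> r" by blast
    thus "\<omega> \<in> (\<Union>z\<in>?P. ?E z)" by (intro UN_I[of "(i, j)"]) auto
  qed auto
  also have "\<dots> \<le> (\<Sum>z\<in>?P. prob (?E z))"
    using E by (intro finite_measure_subadditive_finite finP) blast
  also have "\<dots> \<le> (\<Sum>z\<in>?P. q)"
    using W q by (intro sum_mono prob_dist_le) auto
  also have "\<dots> = card ?P * q" by simp
  also have "\<dots> \<le> (real (card W))\<^sup>2 * q"
  proof (rule mult_right_mono[OF _ q0])
    have "card ?P \<le> card (W \<times> W)" using W by (intro card_mono) auto
    also have "\<dots> = (card W)\<^sup>2" by (simp add: card_cartesian_product power2_eq_square)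
    finally show "real (card ?P) \<le> (real (card W))\<^sup>2" by (simp flip: of_nat_power)
  qed
  finally show ?thesis .
qed

lemma prob_some_isolated_le:
  fixes q :: real
  assumes W: "finite W" "W \<subseteq> I" "2 \<le> card W"
    and q: "AE x in \<mu>. q \<le> measure \<mu> (cball x r)"
  shows "prob {\<omega>\<in>space M. \<exists>i\<in>W. \<forall>j\<in>W - {i}. r < dist (X i \<omega>) (X j \<omega>)}
    \<le> card W * (1 - q) ^ (card W - 1)"
proof -
  have [measurable]: "X i \<in> borel_measurable M" if "i \<in> W" for i
    using W that by auto
  let ?E = "\<lambda>i. {\<omega>\<in>space M. \<forall>j\<in>W - {i}. r < dist (X i \<omega>) (X j \<omega>)}"
  have E: "?E i \<in> events" if "i \<in> W" for i
    using W that by measurable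
  have "prob {\<omega>\<in>space M. \<exists>i\<in>W. \<forall>j\<in>W - {i}. r < dist (X i \<omega>) (X j \<omega>)} = prob (\<Union>i\<in>W. ?E i)"
    by (rule arg_cong[where f = prob]) auto
  also have "\<dots> \<le> (\<Sum>i\<in>W. prob (?E i))"
    using W E by (intro finite_measure_subadditive_finite) auto
  also have "\<dots> \<le> (\<Sum>i\<in>W. (1 - q) ^ (card W - 1))"
  proof (intro sum_mono)
    fix i assume i: "i \<in> W"
    have c: "card (W - {i}) = card W - 1" using i W by simp
    hence "W - {i} \<noteq> {}" using W by (metis card.empty diff_is_0_eq not_less_eq_eq numeral_2_eq_2 One_nat_def)
    hence "prob (?E i) = vacancy r (card W - 1)"
      using i W c by (subst prob_isolated) auto
    also have "\<dots> \<le> (1 - q) ^ (card W - 1)"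
      using i W q by (intro vacancy_le) auto
    finally show "prob (?E i) \<le> (1 - q) ^ (card W - 1)" .
  qed
  finally show ?thesis by simp
qed

end

section \<open>Summability and elementary estimates\<close>

lemma (in prob_space) AE_eventually_notin:
  fixes f :: "nat \<Rightarrow> real"
  assumes B: "\<And>n. B n \<in> events" and le: "\<forall>\<^sub>F n in sequentially. prob (B n) \<le> f n" and f: "summable f"
  shows "AE \<omega> in M. \<forall>\<^sub>F n in sequentially. \<omega> \<notin> B n"
proof -
  have "summable (\<lambda>n. prob (B n))"
    by (rule summable_comparison_test_ev[OF _ f]) (use le in \<open>auto elim!: eventually_mono\<close>)
  hence "AE \<omega> in M. \<forall>\<^sub>F n in sequentially. \<omega> \<in> space M - B n"
    by (intro borel_cantelli_AE1 B) (auto simp: emeasure_eq_measure)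
  thus ?thesis by (auto elim!: eventually_mono)
qed

text \<open>
  The exponent is of order \<open>- N powr (1 - \<alpha>)\<close>, which beats every power of \<open>N\<close>.
\<close>

lemma summable_stretched_exp:
  fixes c \<alpha> :: real
  assumes "0 < c" "\<alpha> < 1"
  shows "summable (\<lambda>N. real N * exp (- c * (real N - 1) / real N powr \<alpha>))"
proof (rule summable_comparison_test_bigo)
  show "summable (\<lambda>N. norm (real N powr -2))"
    by (simp add: summable_real_powr_iff)
  show "(\<lambda>N. real N * exp (- c * (real N - 1) / real N powr \<alpha>)) \<in> O(\<lambda>N. real N powr -2)"
    using assms by real_asymp
qed

lemma exp_minus_double_le:
  fixes x :: real
  assumes "0 \<le> x" "x \<le> 1 / 2"
  shows "exp (- 2 * x) \<le> 1 - x"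
proof -
  have "2 * x\<^sup>2 \<le> x" using mult_left_mono[of x "1 / 2" x] assms by (simp add: power2_eq_square)
  hence "- 2 * x \<le> ln (1 - x)"
    using ln_one_minus_pos_lower_bound[OF assms] by simp
  thus ?thesis using assms by (subst (asm) ln_ge_iff) auto
qed

section \<open>The intersection graph of random caps\<close>

locale uniform_caps = iid_points M X uniform_sphere "{1..}"
  for M :: "'a measure" and X :: "nat \<Rightarrow> 'a \<Rightarrow> real^3" +
  fixes c \<alpha> :: real and a :: "nat \<Rightarrow> real"
  assumes c: "0 < c"
    and radius: "\<forall>\<^sub>F N in sequentially. a N \<in> {0<..pi} \<and> cap_prob (a N) = c / real N powr \<alpha>"
begin

lemma AE_norm_X: "AE \<omega> in M. \<forall>i\<ge>1. norm (X i \<omega>) = 1"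
proof -
  have "AE \<omega> in M. norm (X i \<omega>) = 1" if "i \<ge> 1" for i
  proof -
    have "AE x in distr M borel (X i). norm x = 1"
      using that AE_uniform_sphere_norm by (simp only: distr_X atLeast_iff)
    thus ?thesis using that by (subst (asm) AE_distr_iff) auto
  qed
  hence "AE \<omega> in M. i \<ge> 1 \<longrightarrow> norm (X i \<omega>) = 1" for i by (cases "i \<ge> 1") auto
  thus ?thesis by (simp add: AE_all_countable)
qed

lemma eventually_radius:
  "\<forall>\<^sub>F N in sequentially. 1 \<le> N \<and> 0 \<le> a N \<and> a N \<le> pi \<and>
    0 < cap_prob (a N) \<and> cap_prob (a N) = c / real N powr \<alpha>"
  using radius eventually_ge_at_top[of 1] by eventually_elim (use c in auto)

text \<open>
  The two balls are those of a vertex (centres whose caps can meet its cap) and of doubled radius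
  (centres whose neighbourhoods can overlap its neighbourhood).
\<close>

lemma measure_cball_le:
  assumes "0 < p"
  shows "measure uniform_sphere (cball x (4 * sqrt p)) \<le> 864 * p"
    "measure uniform_sphere (cball x (2 * (4 * sqrt p))) \<le> 3456 * p"
  using measure_uniform_sphere_cball_le[of "4 * sqrt p" x]
    measure_uniform_sphere_cball_le[of "8 * sqrt p" x] assms
  by (auto simp: power_mult_distrib)

lemma AE_eventually_no_isolated:
  assumes "\<alpha> < 1"
  shows "AE \<omega> in M. \<forall>\<^sub>F N in sequentially. \<not> (\<exists>v. isolated (a N) (\<lambda>i. X i \<omega>) N v)"
proof -
  define r where "r N = 2 * sqrt (cap_prob (a N))" for N
  define B where "B N = {\<omega>\<in>space M. \<exists>i\<in>{1..N}. \<forall>j\<in>{1..N} - {i}. r N < dist (X i \<omega>) (X j \<omega>)}" for N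
  have "B N \<in> events" for N
    unfolding B_def by measurable
  moreover have "\<forall>\<^sub>F N in sequentially. prob (B N) \<le> real N * exp (- (c / 128) * (real N - 1) / real N powr \<alpha>)"
    using eventually_radius eventually_ge_at_top[of 2]
  proof eventually_elim
    case (elim N)
    define q where "q = cap_prob (a N) / 128"
    have "cap_prob (a N) \<le> 1" by (simp add: cap_prob_def abs_square_le_1)
    hence "r N \<le> 2" and r: "0 < r N" using elim by (simp_all add: r_def)
    have "AE x in uniform_sphere. q \<le> measure uniform_sphere (cball x (r N))"
      using AE_uniform_sphere_norm
    proof eventually_elim
      case (elim x)
      from measure_uniform_sphere_cball_ge[OF this r \<open>r N \<le> 2\<close>] \<open>0 < r N\<close>
      show ?case by (auto simp: r_def q_def power_mult_distrib)
    qed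
    hence "prob (B N) \<le> card {1..N} * (1 - q) ^ (card {1..N} - 1)"
      unfolding B_def using elim by (intro prob_some_isolated_le) auto
    also have "\<dots> = real N * (1 - q) ^ (N - 1)" by simp
    also have "(1 - q) ^ (N - 1) \<le> exp (- q) ^ (N - 1)"
      using \<open>cap_prob (a N) \<le> 1\<close> exp_ge_add_one_self[of "- q"] by (intro power_mono) (auto simp: q_def)
    also have "\<dots> = exp (- q * (real N - 1))"
      using elim by (simp add: exp_of_nat_mult[symmetric] of_nat_diff mult.commute)
    also have "- q * (real N - 1) = - (c / 128) * (real N - 1) / real N powr \<alpha>"
      using elim by (simp add: q_def)
    finally show ?case by (simp add: mult_left_mono)
  qed
  moreover have "summable (\<lambda>N. real N * exp (- (c / 128) * (real N - 1) / real N powr \<alpha>))"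
    using c assms by (intro summable_stretched_exp) auto
  ultimately have "AE \<omega> in M. \<forall>\<^sub>F N in sequentially. \<omega> \<notin> B N"
    by (rule AE_eventually_notin)
  with AE_norm_X AE_space show ?thesis
  proof eventually_elim
    case (elim \<omega>)
    from elim(3) eventually_radius show ?case
    proof eventually_elim
      case (elim N)
      show ?case
      proof
        assume "\<exists>v. isolated (a N) (\<lambda>i. X i \<omega>) N v"
        then obtain i where i: "i \<in> {1..N}"
          and d: "\<And>j. j \<in> {1..N} - {i} \<Longrightarrow> cap (X i \<omega>) (a N) \<inter> cap (X j \<omega>) (a N) = {}"
          by (auto simp: isolated_iff)
        have "r N < dist (X i \<omega>) (X j \<omega>)" if "j \<in> {1..N} - {i}" for j
        proof (rule ccontr)
          assume "\<not> r N < dist (X i \<omega>) (X j \<omega>)"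
          hence "cap (X i \<omega>) (a N) \<inter> cap (X j \<omega>) (a N) \<noteq> {}"
            using i that elim \<open>\<forall>i\<ge>1. norm (X i \<omega>) = 1\<close>
            by (intro caps_meet_if_dist_le) (auto simp: r_def)
          thus False using d[OF that] by simp
        qed
        hence "\<omega> \<in> B N" unfolding B_def using i \<open>\<omega> \<in> space M\<close> by blast
        thus False using elim by simp
      qed
    qed
  qed
qed

lemma isolated_if_far:
  assumes norm: "\<forall>i\<ge>1. norm (X i \<omega>) = 1" and a: "0 \<le> a N" "a N \<le> pi" and i: "i \<in> {1..N}"
    and far: "\<And>j. j \<in> {1..N} - {i} \<Longrightarrow> 4 * sqrt (cap_prob (a N)) < dist (X i \<omega>) (X j \<omega>)"
  shows "isolated (a N) (\<lambda>i. X i \<omega>) N (X i \<omega>)"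
proof -
  have "cap (X i \<omega>) (a N) \<inter> cap (X j \<omega>) (a N) = {}" if "j \<in> {1..N} - {i}" for j
    using dist_le_if_caps_meet[of "X i \<omega>" "X j \<omega>" "a N"] far[OF that] norm i that a by force
  thus ?thesis unfolding isolated_iff by (intro bexI[OF _ i]) blast
qed

lemma AE_eventually_all_isolated:
  assumes "3 < \<alpha>"
  shows "AE \<omega> in M. \<forall>\<^sub>F N in sequentially.
    \<forall>v\<in>graph_verts (\<lambda>i. X i \<omega>) N. isolated (a N) (\<lambda>i. X i \<omega>) N v"
proof -
  define r where "r N = 4 * sqrt (cap_prob (a N))" for N
  define B where "B N = {\<omega>\<in>space M. \<exists>i\<in>{1..N}. \<exists>j\<in>{1..N} - {i}. dist (X i \<omega>) (X j \<omega>) \<le> r N}" for N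
  have "B N \<in> events" for N
    unfolding B_def by measurable
  moreover have "\<forall>\<^sub>F N in sequentially. prob (B N) \<le> 864 * c * real N powr (2 - \<alpha>)"
    using eventually_radius
  proof eventually_elim
    case (elim N)
    have "prob (B N) \<le> (real (card {1..N}))\<^sup>2 * (864 * cap_prob (a N))"
      unfolding B_def r_def using elim by (intro prob_some_pair_close_le measure_cball_le) auto
    also have "\<dots> = 864 * c * real N powr (2 - \<alpha>)"
      using elim by (simp add: powr_diff)
    finally show ?case .
  qed
  moreover have "summable (\<lambda>N. 864 * c * real N powr (2 - \<alpha>))"
    using assms by (intro summable_mult) (simp add: summable_real_powr_iff)
  ultimately have "AE \<omega> in M. \<forall>\<^sub>F N in sequentially. \<omega> \<notin> B N"
    by (rule AE_eventually_notin)
  with AE_norm_X AE_space show ?thesis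
  proof eventually_elim
    case (elim \<omega>)
    from elim(3) eventually_radius show ?case
    proof eventually_elim
      case (elim N)
      have "r N < dist (X i \<omega>) (X j \<omega>)" if "i \<in> {1..N}" "j \<in> {1..N} - {i}" for i j
        using elim(1) that \<open>\<omega> \<in> space M\<close> by (force simp: B_def)
      hence "isolated (a N) (\<lambda>i. X i \<omega>) N (X i \<omega>)" if "i \<in> {1..N}" for i
        using that elim \<open>\<forall>i\<ge>1. norm (X i \<omega>) = 1\<close> unfolding r_def by (intro isolated_if_far) blast+
      thus ?case by (auto simp: graph_verts_def)
    qed
  qed
qed

text \<open>
  Here \<open>\<alpha> \<ge> 1\<close> enters: each of the \<open>2 * n\<close> points is near a given vertex with probability at most
  \<open>864 * c / n\<close>, so the vertex is isolated with a probability bounded below independently of \<open>n\<close>. The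
  condition \<open>1728 * c \<le> n\<close> makes \<open>864 * c / n\<close> at most \<open>1 / 2\<close>, which \<open>exp_minus_double_le\<close> requires.
\<close>

lemma prob_no_isolated_block_le:
  assumes \<alpha>: "1 \<le> \<alpha>" and n: "2 \<le> n" "1728 * c \<le> real n"
    and p: "0 < p" "p = c / real n powr \<alpha>"
  shows "prob {\<omega>\<in>space M. \<forall>i\<in>{1..n}. \<exists>j\<in>{1..2 * n} - {i}. dist (X i \<omega>) (X j \<omega>) \<le> 4 * sqrt p}
    \<le> (1 + 5184 * c) * exp (6912 * c) / real n"
proof -
  define q where "q = 864 * p"
  have "real n powr 1 \<le> real n powr \<alpha>" using \<alpha> n by (intro powr_mono) auto
  hence "p \<le> c / real n" unfolding p(2) using c n by (intro divide_left_mono) auto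
  hence q: "0 < q" "q \<le> 864 * c / real n" using p by (auto simp: q_def)
  note q(2)
  also have "864 * c / real n \<le> 1 / 2" using n by (simp add: field_simps)
  finally have q2: "q \<le> 1 / 2" .
  have "prob {\<omega>\<in>space M. \<forall>i\<in>{1..n}. \<exists>j\<in>{1..2 * n} - {i}. dist (X i \<omega>) (X j \<omega>) \<le> 4 * sqrt p}
      \<le> (1 / card {1..n} + 3456 * p + 2 * q) / (1 - q) ^ (2 * (card {1..2 * n} - 1))"
    using n p(1) q2 measure_cball_le[OF p(1)] by (intro prob_no_isolated_le) (auto simp: q_def)
  also have "\<dots> = (1 / real n + 5184 * p) / (1 - q) ^ (2 * (2 * n - 1))"
    by (simp add: q_def)
  also have "\<dots> \<le> ((1 + 5184 * c) / real n) / exp (- 6912 * c)"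
  proof (rule frac_le)
    have "q * real n \<le> 864 * c"
      using q(2) n by (simp add: pos_le_divide_eq)
    hence "exp (- 6912 * c) \<le> exp (- 2 * q * (4 * real n))"
      unfolding exp_le_cancel_iff by (simp add: mult.assoc[symmetric])
    also have "\<dots> = exp (- 2 * q) ^ (4 * n)"
      by (simp add: exp_of_nat_mult[symmetric] mult_ac)
    also have "\<dots> \<le> (1 - q) ^ (4 * n)"
      using q q2 by (intro power_mono exp_minus_double_le) auto
    also have "\<dots> \<le> (1 - q) ^ (2 * (2 * n - 1))"
      using q q2 by (intro power_decreasing) auto
    finally show "exp (- 6912 * c) \<le> (1 - q) ^ (2 * (2 * n - 1))" .
    show "1 / real n + 5184 * p \<le> (1 + 5184 * c) / real n"
      using \<open>p \<le> c / real n\<close> by (simp add: add_divide_distrib)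
  qed (use c in auto)
  finally show ?thesis by (simp add: exp_minus field_simps)
qed

text \<open>
  The blocks are \<open>2 ^ k \<le> N < 2 ^ (k + 1)\<close>; a vertex found at the start of a block with the caps of
  that time and the points of the whole block serves every \<open>N\<close> in it.
\<close>

lemma AE_eventually_some_isolated:
  assumes \<alpha>: "1 \<le> \<alpha>"
  shows "AE \<omega> in M. \<forall>\<^sub>F N in sequentially. \<exists>v. isolated (a N) (\<lambda>i. X i \<omega>) N v"
proof -
  define p where "p N = cap_prob (a N)" for N
  define B where "B k = {\<omega>\<in>space M. \<forall>i\<in>{1..2 ^ k}. \<exists>j\<in>{1..2 * 2 ^ k} - {i}.
    dist (X i \<omega>) (X j \<omega>) \<le> 4 * sqrt (p (2 ^ k))}" for k :: nat
  have pow: "filterlim (\<lambda>k. 2 ^ k :: nat) at_top sequentially"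
    by (rule filterlim_subseq) (simp add: strict_mono_def)
  have "B k \<in> events" for k
    unfolding B_def by measurable
  moreover have "\<forall>\<^sub>F k in sequentially. prob (B k) \<le> (1 + 5184 * c) * exp (6912 * c) * (1 / 2) ^ k"
  proof -
    have "\<forall>\<^sub>F n in sequentially. 1728 * c \<le> real n"
      using filterlim_real_sequentially by (simp add: filterlim_at_top)
    with eventually_radius eventually_ge_at_top[of 2]
    have "\<forall>\<^sub>F n in sequentially. 2 \<le> n \<and> 1728 * c \<le> real n \<and> 0 < p n \<and> p n = c / real n powr \<alpha>"
      by eventually_elim (auto simp: p_def)
    hence "\<forall>\<^sub>F k in sequentially. 2 \<le> (2 ^ k :: nat) \<and> 1728 * c \<le> real (2 ^ k) \<and>
        0 < p (2 ^ k) \<and> p (2 ^ k) = c / real (2 ^ k) powr \<alpha>"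
      by (rule eventually_compose_filterlim[OF _ pow])
    thus ?thesis
    proof eventually_elim
      case (elim k)
      hence "prob (B k) \<le> (1 + 5184 * c) * exp (6912 * c) / real (2 ^ k)"
        unfolding B_def by (intro prob_no_isolated_block_le \<alpha>) auto
      thus ?case by (simp add: power_one_over)
    qed
  qed
  moreover have "summable (\<lambda>k. (1 + 5184 * c) * exp (6912 * c) * (1 / 2) ^ k)"
    by (intro summable_mult summable_geometric) auto
  ultimately have "AE \<omega> in M. \<forall>\<^sub>F k in sequentially. \<omega> \<notin> B k"
    by (rule AE_eventually_notin)
  with AE_norm_X AE_space show ?thesis
  proof eventually_elim
    case (elim \<omega>)
    from elim(3) eventually_compose_filterlim[OF eventually_radius pow]
    have "\<forall>\<^sub>F k in sequentially. \<omega> \<notin> B k \<and> p (2 ^ k) = c / real (2 ^ k) powr \<alpha>"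
      by eventually_elim (auto simp: p_def)
    then obtain K where K: "\<And>k. k \<ge> K \<Longrightarrow> \<omega> \<notin> B k \<and> p (2 ^ k) = c / real (2 ^ k) powr \<alpha>"
      by (auto simp: eventually_sequentially)
    from eventually_radius eventually_ge_at_top[of "2 ^ K"] show ?case
    proof eventually_elim
      case N: (elim N)
      obtain k where k: "2 ^ k \<le> N" "N < 2 ^ (k + 1)"
        using ex_power_ivl1[of 2 N] N by auto
      have "(2::nat) ^ K < 2 ^ (k + 1)" using N k by linarith
      hence "K < k + 1" by (rule power_less_imp_less_exp[rotated]) simp
      hence "K \<le> k" by simp
      from K[OF this] obtain i where i: "i \<in> {1..2 ^ k}"
        and far: "\<And>j. j \<in> {1..2 * 2 ^ k} - {i} \<Longrightarrow> 4 * sqrt (p (2 ^ k)) < dist (X i \<omega>) (X j \<omega>)"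
        using \<open>\<omega> \<in> space M\<close> by (force simp: B_def not_le)
      have "real (2 ^ k) powr \<alpha> \<le> real N powr \<alpha>"
        using k(1) \<alpha> by (intro powr_mono2) (auto simp flip: of_nat_power)
      hence "p N \<le> p (2 ^ k)"
        using K[OF \<open>K \<le> k\<close>] N c unfolding p_def by (auto intro!: divide_left_mono)
      hence "4 * sqrt (p N) < dist (X i \<omega>) (X j \<omega>)" if "j \<in> {1..N} - {i}" for j
      proof -
        have "j \<in> {1..2 * 2 ^ k} - {i}" using that k by auto
        moreover have "sqrt (p N) \<le> sqrt (p (2 ^ k))" using \<open>p N \<le> p (2 ^ k)\<close> by simp
        ultimately show ?thesis using far[of j] by linarith
      qed
      hence "isolated (a N) (\<lambda>i. X i \<omega>) N (X i \<omega>)"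
        using elim N i k by (intro isolated_if_far) (auto simp: p_def)
      thus ?case by blast
    qed
  qed
qed

end

theorem proposition4p1:
  fixes M :: "'a measure"
    and X :: "nat \<Rightarrow> 'a \<Rightarrow> real^3"
    and c \<alpha> :: real
    and a :: "nat \<Rightarrow> real"
  assumes prob: "prob_space M"
    and indep: "prob_space.indep_vars M (\<lambda>_. borel) X {1..}"
    and unif: "\<And>i. i \<ge> 1 \<Longrightarrow> distr M borel (X i) = uniform_sphere"
    and c: "c > 0"
    and p: "\<forall>\<^sub>F N in sequentially. c / real N powr \<alpha> \<in> {0<..1}"
    and a: "\<forall>\<^sub>F N in sequentially. a N \<in> {0<..pi} \<and> cap_prob (a N) = c / real N powr \<alpha>"
  shows "(0 < \<alpha> \<and> \<alpha> < 1 \<longrightarrow>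
            (AE \<omega> in M. \<forall>\<^sub>F N in sequentially. \<not> (\<exists>v. isolated (a N) (\<lambda>i. X i \<omega>) N v)))
       \<and> (1 \<le> \<alpha> \<longrightarrow>
            (AE \<omega> in M. \<forall>\<^sub>F N in sequentially. \<exists>v. isolated (a N) (\<lambda>i. X i \<omega>) N v))
       \<and> (3 < \<alpha> \<longrightarrow>
            (AE \<omega> in M. \<forall>\<^sub>F N in sequentially.
               \<forall>v \<in> graph_verts (\<lambda>i. X i \<omega>) N. isolated (a N) (\<lambda>i. X i \<omega>) N v))"
proof -
  interpret prob_space M by (rule prob)
  interpret uniform_caps M X c \<alpha> a
    by unfold_locales (use indep unif c a in auto)
  show ?thesis
    using AE_eventually_no_isolated AE_eventually_some_isolated AE_eventually_all_isolated by blast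
qed

end
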